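(* Let $\kappa>0$ be a real constant, $N\ge1$ an integer, $I\subset\mathbb{R}$ an open interval, $Q_1,\dots,Q_N$ smooth functions on $I$ with $Q_j(t)\neq Q_k(t)$ for all $t\in I$ and $j\ne k$, and $J_0$ a smooth function on $I$. Put $v(t,x)=t-x^2$, $R_k=\sum_{j\neq k}\frac{1}{Q_k-Q_j}$, and define, for $t\in I$ and $x\in\mathbb{R}\setminus\{Q_1(t),\dots,Q_N(t)\}$, $$b_+(t,x)=-\frac1\kappa\sum_{k=1}^N\frac1{x-Q_k(t)},$$ $$2b_1(t,x)=\frac1\kappa\sum_{k=1}^N\frac{\kappa Q_k'+t-Q_k^2-2R_k}{x-Q_k}-\frac2\kappa\sum_{k=1}^NQ_k-J_0(t)+\Big(\frac1N-\frac1\kappa\Big)\sum_{k=1}^N(x-Q_k).$$ Then the equation $$\partial_t(\kappa b_++v)+\partial_x\big(\partial_xb_+-b_+(\kappa b_++v)-2b_1\big)=0$$ holds, and the equation $$\kappa\,\partial_tb_1+\partial_{xx}b_1+v\,\partial_xb_1=2\kappa\, b_1\,\partial_xb_+$$ holds if and only if $N=\kappa$ (so $\kappa$ is a positive integer) and the function $U(t):=\kappa J_0(t)+\sum_{k=1}^\kappa Q_k(t)-\frac{t^2}{2}$ satisfies, together with $Q_1,\dots,Q_\kappa$, on $I$: $$\kappa U'=-\sum_{k=1}^\kappa Q_k^2,$$ and for every $k=1,\dots,\kappa$ the Calogero-type equations of motion $$\kappa^2Q_k''=-2Q_k(t-Q_k^2)+\kappa-2-\sum_{j\neq k}\frac{8}{(Q_k-Q_j)^3}$$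 and the relations $$\frac{(\kappa Q_k')^2}{2}+tQ_k^2-\frac{Q_k^4}{2}-(\kappa-2)Q_k-\sum_{j\neq k}\frac{2}{(Q_k-Q_j)^2}+U-\sum_{j\neq k}\frac{\kappa Q_k'+\kappa Q_j'}{Q_k-Q_j}+\sum_{j\neq k}\ \sum_{l\neq k,j}\frac{2}{(Q_k-Q_j)(Q_j-Q_l)}=0 .$$
   Context: The functions $Q_k$ and $J_0$ may be real- or complex-valued; primes denote $d/dt$; sums over $j$, $l$ run over $\{1,\dots,N\}$ with the indicated exclusions, and empty sums are $0$. The two PDEs for $(b_+,b_1)$ are the governing system associated with the quantum Painlevé II (Fokker–Planck) equation $(\kappa\partial_t+\partial_{xx}+(t-x^2)\partial_x)\mathcal F=0$, where $\kappa=\beta/2$. *)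

theory Defs
  imports "HOL-Analysis.Analysis"
begin

text \<open>Functions take values in an arbitrary real normed field; the instances \<open>real\<close> and
  \<open>complex\<close> are the real- and complex-valued cases. The variables \<open>t\<close> and \<open>x\<close> are always real.\<close>

abbreviation vderiv :: "(real \<Rightarrow> 'a::real_normed_vector) \<Rightarrow> real \<Rightarrow> 'a" where
  "vderiv f \<equiv> (\<lambda>t. vector_derivative f (at t))"

abbreviation partial_t :: "(real \<Rightarrow> real \<Rightarrow> 'a::real_normed_vector) \<Rightarrow> real \<Rightarrow> real \<Rightarrow> 'a" where
  "partial_t F \<equiv> (\<lambda>t x. vector_derivative (\<lambda>s. F s x) (at t))"

abbreviation partial_x :: "(real \<Rightarrow> real \<Rightarrow> 'a::real_normed_vector) \<Rightarrow> real \<Rightarrow> real \<Rightarrow> 'a" where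
  "partial_x F \<equiv> (\<lambda>t x. vector_derivative (\<lambda>y. F t y) (at x))"

text \<open>Only meant for open \<open>S\<close>, where the two-sided derivatives are determined by \<open>f\<close> on \<open>S\<close>.\<close>

definition smooth_on :: "real set \<Rightarrow> (real \<Rightarrow> 'a::real_normed_vector) \<Rightarrow> bool" where
  "smooth_on S f \<longleftrightarrow> (\<forall>n. (vderiv ^^ n) f differentiable_on S)"

definition v :: "real \<Rightarrow> real \<Rightarrow> 'a::real_normed_field" where
  "v t x = of_real (t - x\<^sup>2)"

definition R :: "nat \<Rightarrow> (nat \<Rightarrow> real \<Rightarrow> 'a::real_normed_field) \<Rightarrow> nat \<Rightarrow> real \<Rightarrow> 'a" where
  "R N Q k t = (\<Sum>j\<in>{1..N} - {k}. 1 / (Q k t - Q j t))"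

text \<open>The functions below are total; they are only meaningful at points \<open>x\<close> different
  from all \<open>Q k t\<close>.\<close>

definition b_plus ::
  "real \<Rightarrow> nat \<Rightarrow> (nat \<Rightarrow> real \<Rightarrow> 'a::real_normed_field) \<Rightarrow> real \<Rightarrow> real \<Rightarrow> 'a" where
  "b_plus \<kappa> N Q t x = - (1 / of_real \<kappa>) * (\<Sum>k=1..N. 1 / (of_real x - Q k t))"

definition b_one ::
  "real \<Rightarrow> nat \<Rightarrow> (nat \<Rightarrow> real \<Rightarrow> 'a::real_normed_field) \<Rightarrow> (real \<Rightarrow> 'a) \<Rightarrow> real \<Rightarrow> real \<Rightarrow> 'a" where
  "b_one \<kappa> N Q J0 t x = (1 / 2) *
    ((1 / of_real \<kappa>) *
       (\<Sum>k=1..N. (of_real \<kappa> * vderiv (Q k) t + of_real t - (Q k t)\<^sup>2 - 2 * R N Q k t)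
                 / (of_real x - Q k t))
     - (2 / of_real \<kappa>) * (\<Sum>k=1..N. Q k t)
     - J0 t
     + (1 / of_nat N - 1 / of_real \<kappa>) * (\<Sum>k=1..N. (of_real x - Q k t)))"

definition U ::
  "real \<Rightarrow> nat \<Rightarrow> (nat \<Rightarrow> real \<Rightarrow> 'a::real_normed_field) \<Rightarrow> (real \<Rightarrow> 'a) \<Rightarrow> real \<Rightarrow> 'a" where
  "U \<kappa> N Q J0 t = of_real \<kappa> * J0 t + (\<Sum>k=1..N. Q k t) - (of_real t)\<^sup>2 / 2"

end

theory Submission
  imports Defs
begin

text \<open>For fixed \<open>t\<close>, both equations are identities between rational functions of \<open>x\<close> whose only
  poles are the distinct points \<open>Q k t\<close>. After clearing a factor 2, the triple poles of the second
  equation cancel, and its defect is a sum of simple and double poles plus a quadratic polynomial in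
  \<open>x\<close>. By uniqueness of partial fractions all coefficients must vanish: the \<open>x\<^sup>2\<close> coefficient gives
  \<open>N = \<kappa>\<close>, the constant one the equation for \<open>U'\<close>, the simple poles the equations of motion, and the
  double poles the first-order relations.\<close>

text \<open>The coefficients of \<open>b_one\<close> are tuned to the first equation. Squaring
  \<open>b_plus\<close> puts \<open>2 * R\<close> into its residues, dividing \<open>v\<close> by
  \<open>x - Q k t\<close> yields the term with the sum of the \<open>Q k t\<close> and a linear
  term, and the weight \<open>1 / N\<close> leaves a linear term whose derivative cancels that of
  \<open>v\<close> in time. So the first equation puts no condition on the motion of the poles. In
  the second equation the obstacle is that \<open>x\<close> is real while the poles lie in an
  arbitrary normed field and need not be real, so no limit at a pole is available. Uniqueness of
  partial fractions is therefore purely algebraic, through polynomials with infinitely many roots.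
  The parameter \<open>\<mu> = 1 / N - 1 / \<kappa>\<close> enters the pole coefficients too, so it
  must be shown to vanish before any of them can be read as an equation of motion. Since the
  residues contain \<open>R\<close>, products of pole sums create sums over triples of poles. In the
  simple poles these cancel by antisymmetry; in the double poles they survive as the last term of
  the relations. All these identities use free values \<open>p\<close>, \<open>p'\<close> for the
  derivatives and need no calculus.\<close>

section \<open>Sums over pairs of distinct indices\<close>

lemma sum_offdiag_swap:
  assumes "finite K"
  shows "(\<Sum>k\<in>K. \<Sum>j\<in>K - {k}. f k j) = (\<Sum>k\<in>K. \<Sum>j\<in>K - {k}. f j k)"
proof -
  have sub: "K - {k} = {j \<in> K. j \<noteq> k}" for k by auto
  have "(\<Sum>k\<in>K. \<Sum>j\<in>{j \<in> K. j \<noteq> k}. f k j) = (\<Sum>j\<in>K. \<Sum>k\<in>{k \<in> K. j \<noteq> k}. f k j)"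
    by (rule sum.swap_restrict) (use assms in auto)
  also have "\<dots> = (\<Sum>j\<in>K. \<Sum>k\<in>{k \<in> K. k \<noteq> j}. f k j)"
    by (intro sum.cong) auto
  finally show ?thesis by (simp add: sub)
qed

lemma sum_offdiag_antisym:
  fixes f :: "'b \<Rightarrow> 'b \<Rightarrow> 'a::field_char_0"
  assumes "finite K" and "\<And>j k. j \<in> K \<Longrightarrow> k \<in> K \<Longrightarrow> j \<noteq> k \<Longrightarrow> f k j = - f j k"
  shows "(\<Sum>k\<in>K. \<Sum>j\<in>K - {k}. f k j) = 0"
proof -
  have "(\<Sum>k\<in>K. \<Sum>j\<in>K - {k}. f k j) = (\<Sum>k\<in>K. \<Sum>j\<in>K - {k}. - f j k)"
    by (intro sum.cong refl) (auto intro: assms(2))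
  also have "\<dots> = - (\<Sum>k\<in>K. \<Sum>j\<in>K - {k}. f k j)"
    using sum_offdiag_swap[OF assms(1), of f] by (simp add: sum_negf)
  finally show ?thesis by simp
qed

lemma double_sum_diag:
  assumes "finite K"
  shows "(\<Sum>k\<in>K. \<Sum>j\<in>K. f k j) = (\<Sum>k\<in>K. f k k) + (\<Sum>k\<in>K. \<Sum>j\<in>K - {k}. (f k j :: 'a::comm_monoid_add))"
  unfolding sum.distrib[symmetric]
  by (intro sum.cong refl) (simp add: sum.remove[OF assms])

subsection \<open>Partial fractions\<close>

text \<open>A mixed product splits as \<open>1 / (q k - q j)\<close> times the difference of the
  simple poles at \<open>q k\<close> and \<open>q j\<close>. The two pieces are one term and its
  transpose, hence the factor 2. This is the origin of \<open>R\<close> in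
  \<open>b_one\<close>.\<close>

lemma square_sum_inverse:
  fixes q :: "'b \<Rightarrow> 'a::field"
  assumes "finite K" "inj_on q K" "\<And>k. k \<in> K \<Longrightarrow> x \<noteq> q k"
  shows "(\<Sum>k\<in>K. 1 / (x - q k))\<^sup>2
    = (\<Sum>k\<in>K. 1 / (x - q k)\<^sup>2) + 2 * (\<Sum>k\<in>K. (\<Sum>j\<in>K - {k}. 1 / (q k - q j)) / (x - q k))"
proof -
  let ?g = "\<lambda>k j. 1 / (q k - q j) / (x - q k)"
  have "(\<Sum>k\<in>K. 1 / (x - q k))\<^sup>2 = (\<Sum>k\<in>K. \<Sum>j\<in>K. 1 / (x - q k) * (1 / (x - q j)))"
    by (simp add: power2_eq_square sum_product)
  also have "\<dots> = (\<Sum>k\<in>K. 1 / (x - q k)\<^sup>2) + (\<Sum>k\<in>K. \<Sum>j\<in>K - {k}. 1 / (x - q k) * (1 / (x - q j)))"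
    by (simp add: double_sum_diag[OF assms(1)] power2_eq_square)
  also have "(\<Sum>k\<in>K. \<Sum>j\<in>K - {k}. 1 / (x - q k) * (1 / (x - q j)))
      = (\<Sum>k\<in>K. \<Sum>j\<in>K - {k}. ?g k j + ?g j k)"
  proof (intro sum.cong refl)
    fix k j assume kj: "k \<in> K" "j \<in> K - {k}"
    then have "q k \<noteq> q j" using assms(2) by (auto dest: inj_onD)
    then have "x - q k \<noteq> 0" "x - q j \<noteq> 0" "q k - q j \<noteq> 0" "q j - q k \<noteq> 0"
      using assms(3) kj by auto
    then show "1 / (x - q k) * (1 / (x - q j)) = ?g k j + ?g j k"
      by (simp add: divide_simps) (simp add: algebra_simps)
  qed
  also have "\<dots> = 2 * (\<Sum>k\<in>K. \<Sum>j\<in>K - {k}. ?g k j)"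
    using sum_offdiag_swap[OF assms(1), of ?g] by (simp add: sum.distrib)
  finally show ?thesis by (simp add: sum_divide_distrib)
qed

text \<open>With \<open>y = x - q k\<close> and \<open>d = q k - q j\<close>, the mixed terms follow
  from the expansion of \<open>1 / (y^2 * (y + d))\<close> into
  \<open>1 / (d * y^2) - 1 / (d^2 * y) + 1 / (d^2 * (y + d))\<close>.\<close>

lemma simple_times_double_poles:
  fixes q a :: "'b \<Rightarrow> 'a::field"
  assumes "finite K" "inj_on q K" "\<And>k. k \<in> K \<Longrightarrow> x \<noteq> q k"
  shows "(\<Sum>k\<in>K. a k / (x - q k)) * (\<Sum>k\<in>K. 1 / (x - q k)\<^sup>2)
    = (\<Sum>k\<in>K. a k / (x - q k) ^ 3
        + (\<Sum>j\<in>K - {k}. a j / (q k - q j)) / (x - q k)\<^sup>2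
        + (\<Sum>j\<in>K - {k}. (a k - a j) / (q k - q j)\<^sup>2) / (x - q k))"
proof -
  let ?g = "\<lambda>k j. a j / (q k - q j) / (x - q k)\<^sup>2 - a j / (q k - q j)\<^sup>2 / (x - q k)"
  let ?h = "\<lambda>k j. a j / (q k - q j)\<^sup>2 / (x - q j)"
  have "(\<Sum>k\<in>K. a k / (x - q k)) * (\<Sum>k\<in>K. 1 / (x - q k)\<^sup>2)
      = (\<Sum>k\<in>K. \<Sum>j\<in>K. 1 / (x - q k)\<^sup>2 * (a j / (x - q j)))"
    unfolding sum_product[symmetric] by (rule mult.commute)
  also have "\<dots> = (\<Sum>k\<in>K. a k / (x - q k) ^ 3)
      + (\<Sum>k\<in>K. \<Sum>j\<in>K - {k}. 1 / (x - q k)\<^sup>2 * (a j / (x - q j)))"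
    by (simp add: double_sum_diag[OF assms(1)] power2_eq_square power3_eq_cube mult.assoc)
  also have "(\<Sum>k\<in>K. \<Sum>j\<in>K - {k}. 1 / (x - q k)\<^sup>2 * (a j / (x - q j)))
      = (\<Sum>k\<in>K. \<Sum>j\<in>K - {k}. ?g k j + ?h k j)"
  proof (intro sum.cong refl)
    fix k j assume kj: "k \<in> K" "j \<in> K - {k}"
    then have "q k \<noteq> q j" using assms(2) by (auto dest: inj_onD)
    then have nz: "x - q k \<noteq> 0" "x - q j \<noteq> 0" "q k - q j \<noteq> 0" using assms(3) kj by auto
    define y d where "y = x - q k" and "d = q k - q j"
    have yd: "x - q j = y + d" by (simp add: y_def d_def)
    have "y \<noteq> 0" "d \<noteq> 0" "y + d \<noteq> 0" using nz by (simp_all add: y_def d_def)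
    then have "1 / y\<^sup>2 * (a j / (y + d)) = a j / d / y\<^sup>2 - a j / d\<^sup>2 / y + a j / d\<^sup>2 / (y + d)"
      by (simp add: divide_simps) algebra
    then show "1 / (x - q k)\<^sup>2 * (a j / (x - q j)) = ?g k j + ?h k j"
      by (simp only: yd y_def[symmetric] d_def[symmetric])
  qed
  also have "\<dots> = (\<Sum>k\<in>K. \<Sum>j\<in>K - {k}. ?g k j) + (\<Sum>k\<in>K. \<Sum>j\<in>K - {k}. ?h k j)"
    by (simp add: sum.distrib)
  \<comment> \<open>The last piece has its pole at \<open>q j\<close>; exchanging the indices moves
    it to \<open>q k\<close>, where it supplies the \<open>a k\<close> of the difference
    \<open>a k - a j\<close>.\<close>
  also have "(\<Sum>k\<in>K. \<Sum>j\<in>K - {k}. ?h k j) = (\<Sum>k\<in>K. \<Sum>j\<in>K - {k}. ?h j k)"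
    by (rule sum_offdiag_swap[OF assms(1)])
  also have "(\<Sum>k\<in>K. \<Sum>j\<in>K - {k}. ?g k j) + \<dots>
      = (\<Sum>k\<in>K. (\<Sum>j\<in>K - {k}. a j / (q k - q j)) / (x - q k)\<^sup>2
        + (\<Sum>j\<in>K - {k}. (a k - a j) / (q k - q j)\<^sup>2) / (x - q k))"
    unfolding sum.distrib[symmetric] sum_divide_distrib
    by (intro sum.cong refl) (simp add: diff_divide_distrib power2_commute)
  finally show ?thesis by (simp add: sum.distrib add.assoc)
qed

text \<open>Each factor is recentred as \<open>x - q j = (x - q k) + (q k - q j)\<close>. The
  diagonal \<open>j = k\<close> is kept, so the simple poles count all of \<open>K\<close>.\<close>

lemma linear_times_double_poles:
  fixes q :: "'b \<Rightarrow> 'a::field"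
  assumes "\<And>k. k \<in> K \<Longrightarrow> x \<noteq> q k"
  shows "(\<Sum>k\<in>K. x - q k) * (\<Sum>k\<in>K. 1 / (x - q k)\<^sup>2)
    = (\<Sum>k\<in>K. (\<Sum>j\<in>K. q k - q j) / (x - q k)\<^sup>2 + of_nat (card K) / (x - q k))"
proof -
  have "(\<Sum>k\<in>K. x - q k) * (\<Sum>k\<in>K. 1 / (x - q k)\<^sup>2)
      = (\<Sum>k\<in>K. \<Sum>j\<in>K. 1 / (x - q k)\<^sup>2 * (x - q j))"
    unfolding sum_product[symmetric] by (rule mult.commute)
  also have "\<dots> = (\<Sum>k\<in>K. \<Sum>j\<in>K. (q k - q j) / (x - q k)\<^sup>2 + 1 / (x - q k))"
  proof (intro sum.cong refl)
    fix k j assume "k \<in> K"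
    then have "x - q k \<noteq> 0" using assms by auto
    then show "1 / (x - q k)\<^sup>2 * (x - q j) = (q k - q j) / (x - q k)\<^sup>2 + 1 / (x - q k)"
      by (simp add: divide_simps) (simp add: algebra_simps power2_eq_square)
  qed
  finally show ?thesis by (simp add: sum.distrib sum_divide_distrib)
qed

text \<open>Clearing denominators gives a polynomial that vanishes on an infinite set, hence
  identically; it may then be evaluated at a node even if that node is far from \<open>S\<close>.
  The set \<open>S\<close> is later the copy of the real line inside the field.\<close>

lemma partial_fraction_unique:
  fixes q \<alpha> \<beta> :: "'b \<Rightarrow> 'a::field"
  assumes K: "finite K" "inj_on q K" and S: "infinite S"
    and eq: "\<And>x. x \<in> S \<Longrightarrow> (\<forall>k\<in>K. x \<noteq> q k) \<Longrightarrow>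
      (\<Sum>k\<in>K. \<alpha> k / (x - q k) + \<beta> k / (x - q k)\<^sup>2) + poly p x = 0"
  shows "p = 0" and "\<And>k. k \<in> K \<Longrightarrow> \<alpha> k = 0" and "\<And>k. k \<in> K \<Longrightarrow> \<beta> k = 0"
proof -
  define T where "T = S - q ` K"
  have T: "infinite T" "\<And>x k. x \<in> T \<Longrightarrow> k \<in> K \<Longrightarrow> x - q k \<noteq> 0"
    using S K(1) by (auto simp: T_def)
  have zero: "r = 0" if "\<And>x. x \<in> T \<Longrightarrow> poly r x = 0" for r :: "'a poly"
    using that T(1) poly_roots_finite[of r] finite_subset[of T "{x. poly r x = 0}"] by blast
  have eqT: "(\<Sum>k\<in>K. \<alpha> k / (x - q k) + \<beta> k / (x - q k)\<^sup>2) + poly p x = 0" if "x \<in> T" for x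
    using eq[of x] that by (auto simp: T_def)
  have ne: "q k - q j \<noteq> 0" if "k \<in> K" "j \<in> K - {k}" for k j
    using that K(2) by (auto dest: inj_onD)
  have pw: "(\<Prod>j\<in>K. c j) = c k * (\<Prod>j\<in>K - {k}. c j)" if "k \<in> K" for k and c :: "'b \<Rightarrow> 'a"
    using prod.remove[OF K(1) that] .
  show \<beta>: "\<beta> k = 0" if k: "k \<in> K" for k
  proof -
    \<comment> \<open>The numerator over the squared denominators. At \<open>q k\<close> every
      summand with \<open>i \<noteq> k\<close> contains the factor \<open>(q k - q k)^2\<close>, and
      the part with \<open>\<alpha> k\<close> vanishes too, so only \<open>\<beta> k\<close> is
      left.\<close>
    define r where "r = (\<Sum>i\<in>K. (smult (\<alpha> i) [:- q i, 1:] + [:\<beta> i:]) * (\<Prod>j\<in>K - {i}. [:- q j, 1:]\<^sup>2))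
       + p * (\<Prod>j\<in>K. [:- q j, 1:]\<^sup>2)"
    have rx: "poly r x = (\<Sum>i\<in>K. (\<alpha> i * (x - q i) + \<beta> i) * (\<Prod>j\<in>K - {i}. (x - q j)\<^sup>2))
       + poly p x * (\<Prod>j\<in>K. (x - q j)\<^sup>2)" for x
      by (simp add: r_def poly_sum poly_prod algebra_simps)
    have "poly r x = 0" if x: "x \<in> T" for x
    proof -
      have "poly r x = ((\<Sum>k\<in>K. \<alpha> k / (x - q k) + \<beta> k / (x - q k)\<^sup>2) + poly p x) * (\<Prod>j\<in>K. (x - q j)\<^sup>2)"
        unfolding rx distrib_right[of "sum f K" for f] sum_distrib_right
      proof (intro arg_cong2[where f = "(+)"] sum.cong refl)
        fix i assume i: "i \<in> K"
        have "x - q i \<noteq> 0" using T(2) x i by blast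
        then show "(\<alpha> i * (x - q i) + \<beta> i) * (\<Prod>j\<in>K - {i}. (x - q j)\<^sup>2)
          = (\<alpha> i / (x - q i) + \<beta> i / (x - q i)\<^sup>2) * (\<Prod>j\<in>K. (x - q j)\<^sup>2)"
          unfolding pw[OF i] by (simp add: distrib_right power2_eq_square)
      qed
      then show ?thesis using eqT[OF x] by simp
    qed
    then have "r = 0" by (rule zero)
    then have "0 = poly r (q k)" by simp
    also have "poly r (q k) = \<beta> k * (\<Prod>j\<in>K - {k}. (q k - q j)\<^sup>2)
        + (\<Sum>i\<in>K - {k}. (\<alpha> i * (q k - q i) + \<beta> i) * (\<Prod>j\<in>K - {i}. (q k - q j)\<^sup>2))"
      unfolding rx sum.remove[OF K(1) k] pw[OF k] by simp
    also have "(\<Sum>i\<in>K - {k}. (\<alpha> i * (q k - q i) + \<beta> i) * (\<Prod>j\<in>K - {i}. (q k - q j)\<^sup>2)) = 0"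
      by (intro sum.neutral ballI mult_eq_0_iff[THEN iffD2] disjI2 prod_zero)
        (use K(1) k in \<open>auto intro!: bexI[of _ k]\<close>)
    finally show ?thesis using ne[OF k] K(1) by auto
  qed
  have eqT': "(\<Sum>k\<in>K. \<alpha> k / (x - q k)) + poly p x = 0" if "x \<in> T" for x
    using eqT[OF that] \<beta> by simp
  show \<alpha>: "\<alpha> k = 0" if k: "k \<in> K" for k
  proof -
    \<comment> \<open>Now that all \<open>\<beta>\<close> vanish, only first powers are cleared;
      with squares the contribution of \<open>\<alpha> k\<close> would again be lost at
      \<open>q k\<close>.\<close>
    define r where "r = (\<Sum>i\<in>K. smult (\<alpha> i) (\<Prod>j\<in>K - {i}. [:- q j, 1:])) + p * (\<Prod>j\<in>K. [:- q j, 1:])"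
    have rx: "poly r x = (\<Sum>i\<in>K. \<alpha> i * (\<Prod>j\<in>K - {i}. x - q j)) + poly p x * (\<Prod>j\<in>K. x - q j)" for x
      by (simp add: r_def poly_sum poly_prod algebra_simps)
    have "poly r x = 0" if x: "x \<in> T" for x
    proof -
      have "poly r x = ((\<Sum>k\<in>K. \<alpha> k / (x - q k)) + poly p x) * (\<Prod>j\<in>K. x - q j)"
        unfolding rx distrib_right[of "sum f K" for f] sum_distrib_right
      proof (intro arg_cong2[where f = "(+)"] sum.cong refl)
        fix i assume i: "i \<in> K"
        have "x - q i \<noteq> 0" using T(2) x i by blast
        then show "\<alpha> i * (\<Prod>j\<in>K - {i}. x - q j) = \<alpha> i / (x - q i) * (\<Prod>j\<in>K. x - q j)"
          unfolding pw[OF i] by simp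
      qed
      then show ?thesis using eqT'[OF x] by simp
    qed
    then have "r = 0" by (rule zero)
    then have "0 = poly r (q k)" by simp
    also have "poly r (q k) = \<alpha> k * (\<Prod>j\<in>K - {k}. q k - q j)
        + (\<Sum>i\<in>K - {k}. \<alpha> i * (\<Prod>j\<in>K - {i}. q k - q j))"
      unfolding rx sum.remove[OF K(1) k] pw[OF k] by simp
    also have "(\<Sum>i\<in>K - {k}. \<alpha> i * (\<Prod>j\<in>K - {i}. q k - q j)) = 0"
      by (intro sum.neutral ballI mult_eq_0_iff[THEN iffD2] disjI2 prod_zero)
        (use K(1) k in \<open>auto intro!: bexI[of _ k]\<close>)
    finally show ?thesis using ne[OF k] K(1) by auto
  qed
  show "p = 0" by (rule zero) (use eqT' \<alpha> in simp)
qed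

subsection \<open>Sums over distinct nodes\<close>

lemma sum_R_eq_0:
  fixes q :: "'b \<Rightarrow> 'a::field_char_0"
  assumes "finite K"
  shows "(\<Sum>k\<in>K. \<Sum>j\<in>K - {k}. 1 / (q k - q j)) = 0"
  by (rule sum_offdiag_antisym[OF assms]) (metis minus_diff_eq minus_divide_right)

lemma sum_remove2:
  fixes f :: "'b \<Rightarrow> 'a::comm_monoid_add"
  assumes "finite K" "k \<in> K" "j \<in> K - {k}"
  shows "(\<Sum>l\<in>K - {j}. f l) = f k + (\<Sum>l\<in>K - {k, j}. f l)"
proof -
  have "K - {j} - {k} = K - {k, j}" by auto
  then show ?thesis using sum.remove[of "K - {j}" k f] assms by auto
qed

text \<open>In \<open>r k - r j\<close> the two nodes see each other with opposite signs, which
  gives \<open>2 / (q k - q j)\<close>. Every third node \<open>l\<close> leaves, after the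
  division, \<open>- 1 / ((q k - q j) * (q k - q l) * (q j - q l))\<close>, which is antisymmetric
  in \<open>j\<close> and \<open>l\<close> and sums to zero. This removes three-body forces from the
  equations of motion.\<close>

lemma sum_diff_R:
  fixes q :: "'b \<Rightarrow> 'a::field_char_0"
  assumes K: "finite K" "inj_on q K" and k: "k \<in> K"
  defines "r \<equiv> \<lambda>k. \<Sum>j\<in>K - {k}. 1 / (q k - q j)"
  shows "(\<Sum>j\<in>K - {k}. (r k - r j) / (q k - q j)\<^sup>2) = (\<Sum>j\<in>K - {k}. 2 / (q k - q j) ^ 3)"
proof -
  let ?f = "\<lambda>j l. 1 / ((q k - q j) * (q k - q l) * (q j - q l))"
  have ne: "q i - q j \<noteq> 0" if "i \<in> K" "j \<in> K" "i \<noteq> j" for i j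
    using that K(2) by (auto dest: inj_onD)
  have "(r k - r j) / (q k - q j)\<^sup>2 = 2 / (q k - q j) ^ 3 - (\<Sum>l\<in>K - {k} - {j}. ?f j l)"
    if j: "j \<in> K - {k}" for j
  proof -
    have s: "K - {k} - {j} = K - {k, j}" "K - {j, k} = K - {k, j}" by auto
    have d: "q k - q j \<noteq> 0" using ne k j by auto
    have "r k - r j = 1 / (q k - q j) - 1 / (q j - q k)
        + (\<Sum>l\<in>K - {k, j}. 1 / (q k - q l) - 1 / (q j - q l))"
      unfolding r_def sum_remove2[OF K(1) k j] using sum.remove[of "K - {k}" j] K(1) j
      by (simp add: sum_subtractf s)
    also have "1 / (q k - q j) - 1 / (q j - q k) = 2 / (q k - q j)"
      unfolding minus_diff_eq[of "q k" "q j", symmetric] minus_divide_right[symmetric]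
      by (simp add: add_divide_distrib[symmetric])
    also have "(\<Sum>l\<in>K - {k, j}. 1 / (q k - q l) - 1 / (q j - q l))
        = - ((q k - q j)\<^sup>2 * (\<Sum>l\<in>K - {k, j}. ?f j l))"
      unfolding sum_distrib_left sum_negf[symmetric]
    proof (intro sum.cong refl)
      fix l assume l: "l \<in> K - {k, j}"
      have "q k - q l \<noteq> 0" "q j - q l \<noteq> 0" using ne j k l by auto
      then show "1 / (q k - q l) - 1 / (q j - q l) = - ((q k - q j)\<^sup>2 * ?f j l)"
        using d by (simp add: divide_simps) (simp add: algebra_simps power2_eq_square)
    qed
    finally have "r k - r j = 2 / (q k - q j) - (q k - q j)\<^sup>2 * (\<Sum>l\<in>K - {k, j}. ?f j l)"
      by simp
    then show ?thesis
      unfolding s using d by (simp only: diff_divide_distrib) (simp add: power2_eq_square power3_eq_cube)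
  qed
  then have "(\<Sum>j\<in>K - {k}. (r k - r j) / (q k - q j)\<^sup>2)
      = (\<Sum>j\<in>K - {k}. 2 / (q k - q j) ^ 3) - (\<Sum>j\<in>K - {k}. \<Sum>l\<in>K - {k} - {j}. ?f j l)"
    by (simp add: sum_subtractf)
  also have "(\<Sum>j\<in>K - {k}. \<Sum>l\<in>K - {k} - {j}. ?f j l) = 0"
  proof (rule sum_offdiag_antisym)
    fix j l
    have "(q k - q l) * (q k - q j) * (q l - q j) = - ((q k - q j) * (q k - q l) * (q j - q l))"
      by algebra
    then show "?f l j = - ?f j l" by (simp only: minus_divide_right)
  qed (use K in simp)
  finally show ?thesis by simp
qed

text \<open>The left side is \<open>\<kappa>\<close> times the coefficient of the simple pole at
  \<open>q k\<close>, without its \<open>\<mu>\<close> term. The velocity sums from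
  \<open>a'\<close> and from the product cancel, and \<open>- 2 * r\<close> in \<open>a\<close>
  turns \<open>sum_diff_R\<close> into \<open>4 * 2 = 8\<close>. The squares in \<open>a\<close>
  give \<open>1 - 2 * q k / (q k - q j)\<close> for each \<open>j\<close>: the ones add up to
  \<open>card K - 1\<close>, the rest cancels \<open>r k\<close>.\<close>

lemma residue_equation:
  fixes q p p' :: "'b \<Rightarrow> 'a::field_char_0" and \<kappa> t :: 'a
  assumes K: "finite K" "inj_on q K" and k: "k \<in> K"
  defines "r \<equiv> \<lambda>k. \<Sum>j\<in>K - {k}. 1 / (q k - q j)"
  defines "a \<equiv> \<lambda>k. \<kappa> * p k + t - (q k)\<^sup>2 - 2 * r k"
  shows "\<kappa> * (\<kappa> * p' k + 1 - 2 * q k * p k + 2 * (\<Sum>j\<in>K - {k}. (p k - p j) / (q k - q j)\<^sup>2))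
      + 2 * q k * a k - 2 * (\<Sum>j\<in>K - {k}. (a k - a j) / (q k - q j)\<^sup>2)
    = \<kappa>\<^sup>2 * p' k + 2 * q k * (t - (q k)\<^sup>2) + \<kappa> - 2 * (of_nat (card K) - 1)
      + (\<Sum>j\<in>K - {k}. 8 / (q k - q j) ^ 3)"
proof -
  have ne: "q k - q j \<noteq> 0" if "j \<in> K - {k}" for j
    using that K(2) k by (auto dest: inj_onD)
  have "(\<Sum>j\<in>K - {k}. (a k - a j) / (q k - q j)\<^sup>2)
      = (\<Sum>j\<in>K - {k}. \<kappa> * ((p k - p j) / (q k - q j)\<^sup>2) + 1 - 2 * q k * (1 / (q k - q j))
          - 2 * ((r k - r j) / (q k - q j)\<^sup>2))"
  proof (intro sum.cong refl)
    fix j assume "j \<in> K - {k}"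
    then show "(a k - a j) / (q k - q j)\<^sup>2 = \<kappa> * ((p k - p j) / (q k - q j)\<^sup>2) + 1
        - 2 * q k * (1 / (q k - q j)) - 2 * ((r k - r j) / (q k - q j)\<^sup>2)"
      using ne[of j] unfolding a_def
      by (simp add: divide_simps) (simp add: algebra_simps power2_eq_square)
  qed
  also have "\<dots> = \<kappa> * (\<Sum>j\<in>K - {k}. (p k - p j) / (q k - q j)\<^sup>2) + of_nat (card (K - {k}))
      - 2 * q k * r k - 2 * (\<Sum>j\<in>K - {k}. (r k - r j) / (q k - q j)\<^sup>2)"
    by (simp only: sum.distrib sum_subtractf sum_distrib_left[symmetric] r_def) simp
  also have "(\<Sum>j\<in>K - {k}. (r k - r j) / (q k - q j)\<^sup>2) = 2 * (\<Sum>j\<in>K - {k}. 1 / (q k - q j) ^ 3)"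
    using sum_diff_R[OF K k] by (simp add: r_def sum_distrib_left)
  also have "of_nat (card (K - {k})) = (of_nat (card K) - 1 :: 'a)"
    using card_gt_0_iff[of K] K k by (auto simp: card_Diff_singleton of_nat_diff)
  finally have *: "(\<Sum>j\<in>K - {k}. (a k - a j) / (q k - q j)\<^sup>2)
    = \<kappa> * (\<Sum>j\<in>K - {k}. (p k - p j) / (q k - q j)\<^sup>2) + (of_nat (card K) - 1)
      - 2 * q k * r k - 2 * (2 * (\<Sum>j\<in>K - {k}. 1 / (q k - q j) ^ 3))" .
  have "(\<Sum>j\<in>K - {k}. 8 / (q k - q j) ^ 3) = 8 * (\<Sum>j\<in>K - {k}. 1 / (q k - q j) ^ 3)"
    by (simp add: sum_distrib_left)
  then show ?thesis
    unfolding * unfolding a_def by (simp add: algebra_simps power2_eq_square)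
qed

text \<open>Each \<open>a j\<close> is compared with index \<open>k\<close>:
  \<open>p j = (p k + p j) - p k\<close>, \<open>q j\<close> squared is recentred at
  \<open>q k\<close>, and node \<open>k\<close> is split off from \<open>r j\<close>. The terms with
  \<open>r k\<close> then cancel those of
  \<open>a k * (\<kappa> * p k - (t - (q k)\<^sup>2))\<close>. The remaining difference of squares
  contributes \<open>- t\<^sup>2 / 2\<close>, and one of the two sums of the \<open>q j\<close> is
  used up by \<open>q k + q j\<close>; together with \<open>\<kappa> * J\<close> the leftovers form
  exactly \<open>U\<close>.\<close>

lemma double_pole_equation:
  fixes q p :: "'b \<Rightarrow> 'a::field_char_0" and \<kappa> t J :: 'a
  assumes K: "finite K" "inj_on q K" and k: "k \<in> K"
  defines "r \<equiv> \<lambda>k. \<Sum>j\<in>K - {k}. 1 / (q k - q j)"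
  defines "a \<equiv> \<lambda>k. \<kappa> * p k + t - (q k)\<^sup>2 - 2 * r k"
  shows "a k * (\<kappa> * p k - (t - (q k)\<^sup>2)) - 2 * (\<Sum>j\<in>K - {k}. a j / (q k - q j))
      + 2 * (2 * (\<Sum>j\<in>K. q j) + \<kappa> * J)
    = 2 * ((\<kappa> * p k)\<^sup>2 / 2 + t * (q k)\<^sup>2 - (q k) ^ 4 / 2 - (of_nat (card K) - 2) * q k
        - (\<Sum>j\<in>K - {k}. 2 / (q k - q j)\<^sup>2)
        + (\<kappa> * J + (\<Sum>j\<in>K. q j) - t\<^sup>2 / 2)
        - (\<Sum>j\<in>K - {k}. (\<kappa> * p k + \<kappa> * p j) / (q k - q j))
        + (\<Sum>j\<in>K - {k}. \<Sum>l\<in>K - {k, j}. 2 / ((q k - q j) * (q j - q l))))"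
proof -
  have ne: "q k - q j \<noteq> 0" if "j \<in> K - {k}" for j
    using that K(2) k by (auto dest: inj_onD)
  let ?s = "\<lambda>j. \<Sum>l\<in>K - {k, j}. 1 / (q j - q l)"
  have "(\<Sum>j\<in>K - {k}. a j / (q k - q j))
      = (\<Sum>j\<in>K - {k}. (\<kappa> * p k + \<kappa> * p j) / (q k - q j) + (q k + q j)
          + (t - (q k)\<^sup>2 - \<kappa> * p k) * (1 / (q k - q j))
          + 2 / (q k - q j)\<^sup>2 - 2 * (?s j / (q k - q j)))"
  proof (intro sum.cong refl)
    fix j assume j: "j \<in> K - {k}"
    have "q j - q k \<noteq> 0" using ne[OF j] by auto
    then show "a j / (q k - q j) = (\<kappa> * p k + \<kappa> * p j) / (q k - q j) + (q k + q j)
          + (t - (q k)\<^sup>2 - \<kappa> * p k) * (1 / (q k - q j))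
          + 2 / (q k - q j)\<^sup>2 - 2 * (?s j / (q k - q j))"
      using ne[OF j] unfolding a_def r_def sum_remove2[OF K(1) k j]
      by (simp add: divide_simps) (simp add: algebra_simps power2_eq_square)
  qed
  also have "\<dots> = (\<Sum>j\<in>K - {k}. (\<kappa> * p k + \<kappa> * p j) / (q k - q j)) + (\<Sum>j\<in>K - {k}. q k + q j)
          + (t - (q k)\<^sup>2 - \<kappa> * p k) * r k
          + (\<Sum>j\<in>K - {k}. 2 / (q k - q j)\<^sup>2) - 2 * (\<Sum>j\<in>K - {k}. ?s j / (q k - q j))"
    by (simp only: sum.distrib sum_subtractf sum_distrib_left[symmetric] r_def)
  also have "(\<Sum>j\<in>K - {k}. q k + q j) = (of_nat (card K) - 2) * q k + (\<Sum>j\<in>K. q j)"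
    using card_gt_0_iff[of K] K k
    by (auto simp: sum.distrib sum.remove[OF K(1) k] card_Diff_singleton of_nat_diff algebra_simps)
  finally have *: "(\<Sum>j\<in>K - {k}. a j / (q k - q j)) =
      (\<Sum>j\<in>K - {k}. (\<kappa> * p k + \<kappa> * p j) / (q k - q j)) + ((of_nat (card K) - 2) * q k + (\<Sum>j\<in>K. q j))
          + (t - (q k)\<^sup>2 - \<kappa> * p k) * r k
          + (\<Sum>j\<in>K - {k}. 2 / (q k - q j)\<^sup>2) - 2 * (\<Sum>j\<in>K - {k}. ?s j / (q k - q j))" .
  have s: "(\<Sum>j\<in>K - {k}. \<Sum>l\<in>K - {k, j}. 2 / ((q k - q j) * (q j - q l)))
      = 2 * (\<Sum>j\<in>K - {k}. ?s j / (q k - q j))"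
    by (simp add: sum_distrib_left sum_divide_distrib mult.commute)
  show ?thesis
    unfolding * s unfolding a_def by (simp add: field_simps power2_eq_square power4_eq_xxxx)
qed

text \<open>The left side is twice the defect of the second equation, with all derivatives replaced
  by free values; \<open>a k / \<kappa>\<close> stands for the residues of \<open>2 * b_one\<close>.
  The \<open>\<mu>\<close> terms stay separate because nothing relates \<open>\<mu>\<close> to
  \<open>\<kappa>\<close> yet.\<close>

lemma master_expansion:
  fixes q p a a' :: "'b \<Rightarrow> 'a::field" and \<kappa> \<mu> t c c' x :: 'a
  assumes K: "finite K" "inj_on q K" and x: "\<And>k. k \<in> K \<Longrightarrow> x \<noteq> q k" and \<kappa>: "\<kappa> \<noteq> 0"
  shows "(\<Sum>k\<in>K. a' k / (x - q k) + a k * p k / (x - q k)\<^sup>2) - \<kappa> * c' - \<kappa> * \<mu> * (\<Sum>k\<in>K. p k)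
      + 2 / \<kappa> * (\<Sum>k\<in>K. a k / (x - q k) ^ 3)
      + (t - x\<^sup>2) * (\<mu> * of_nat (card K) - 1 / \<kappa> * (\<Sum>k\<in>K. a k / (x - q k)\<^sup>2))
      - 2 * (1 / \<kappa> * (\<Sum>k\<in>K. a k / (x - q k)) - c + \<mu> * (\<Sum>k\<in>K. x - q k)) * (\<Sum>k\<in>K. 1 / (x - q k)\<^sup>2)
    = (\<Sum>k\<in>K.
        ((\<kappa> * a' k + 2 * q k * a k - 2 * (\<Sum>j\<in>K - {k}. (a k - a j) / (q k - q j)\<^sup>2)) / \<kappa>
          - 2 * \<mu> * of_nat (card K)) / (x - q k)
        + ((a k * (\<kappa> * p k - (t - (q k)\<^sup>2)) - 2 * (\<Sum>j\<in>K - {k}. a j / (q k - q j)) + 2 * (\<kappa> * c)) / \<kappa>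
          - 2 * \<mu> * (\<Sum>j\<in>K. q k - q j)) / (x - q k)\<^sup>2)
      + poly [:- \<kappa> * c' - \<kappa> * \<mu> * (\<Sum>k\<in>K. p k) + \<mu> * of_nat (card K) * t + 1 / \<kappa> * (\<Sum>k\<in>K. a k),
          0, - \<mu> * of_nat (card K):] x"
proof -
  define D A L where "D k = (\<Sum>j\<in>K - {k}. (a k - a j) / (q k - q j)\<^sup>2)"
    and "A k = (\<Sum>j\<in>K - {k}. a j / (q k - q j))" and "L k = (\<Sum>j\<in>K. q k - q j)" for k
  note D = D_def[symmetric] and A = A_def[symmetric] and L = L_def[symmetric]
  let ?n = "of_nat (card K) :: 'a"
  let ?v = "\<lambda>k. a k * (t - (q k)\<^sup>2) / (x - q k)\<^sup>2 - 2 * q k * a k / (x - q k) - a k"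
  \<comment> \<open>Expansion at the pole: \<open>t - x\<^sup>2 = (t - (q k)\<^sup>2) - 2 * q k * (x
    - q k) - (x - q k)\<^sup>2\<close>. The last term produces the constant
    \<open>- a k\<close>.\<close>
  have v: "(t - x\<^sup>2) * (\<Sum>k\<in>K. a k / (x - q k)\<^sup>2) = (\<Sum>k\<in>K. ?v k)"
    unfolding sum_distrib_left
  proof (intro sum.cong refl)
    fix k assume "k \<in> K"
    then have "x - q k \<noteq> 0" using x by auto
    then show "(t - x\<^sup>2) * (a k / (x - q k)\<^sup>2) = ?v k"
      by (simp add: divide_simps) (simp add: algebra_simps power2_eq_square)
  qed
  let ?F = "\<lambda>k. ((\<kappa> * a' k + 2 * q k * a k - 2 * D k) / \<kappa> - 2 * \<mu> * ?n) / (x - q k)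
        + ((a k * (\<kappa> * p k - (t - (q k)\<^sup>2)) - 2 * A k + 2 * (\<kappa> * c)) / \<kappa> - 2 * \<mu> * L k) / (x - q k)\<^sup>2"
  have main: "(\<Sum>k\<in>K. a' k / (x - q k) + a k * p k / (x - q k)\<^sup>2)
      + 2 / \<kappa> * (\<Sum>k\<in>K. a k / (x - q k) ^ 3) - 1 / \<kappa> * (\<Sum>k\<in>K. ?v k)
      - 2 / \<kappa> * (\<Sum>k\<in>K. a k / (x - q k) ^ 3 + A k / (x - q k)\<^sup>2 + D k / (x - q k))
      + 2 * c * (\<Sum>k\<in>K. 1 / (x - q k)\<^sup>2)
      - 2 * \<mu> * (\<Sum>k\<in>K. L k / (x - q k)\<^sup>2 + ?n / (x - q k))
    = (\<Sum>k\<in>K. ?F k + 1 / \<kappa> * a k)"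
    unfolding sum_distrib_left sum.distrib[symmetric] sum_subtractf[symmetric]
  proof (intro sum.cong refl)
    fix k
    \<comment> \<open>In terms of the inverse \<open>i\<close> the claim is polynomial, so it needs
      no assumption that \<open>y\<close> is nonzero.\<close>
    define y i where "y = x - q k" and "i = 1 / y"
    have i: "X / y = X * i" "X / y\<^sup>2 = X * i\<^sup>2" "X / y ^ 3 = X * i ^ 3" for X
      by (simp_all add: i_def power_one_over)
    show "a' k / (x - q k) + a k * p k / (x - q k)\<^sup>2 + 2 / \<kappa> * (a k / (x - q k) ^ 3) - 1 / \<kappa> * ?v k
        - 2 / \<kappa> * (a k / (x - q k) ^ 3 + A k / (x - q k)\<^sup>2 + D k / (x - q k))
        + 2 * c * (1 / (x - q k)\<^sup>2) - 2 * \<mu> * (L k / (x - q k)\<^sup>2 + ?n / (x - q k))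
      = ?F k + 1 / \<kappa> * a k"
      unfolding y_def[symmetric] i
      using \<kappa> by (simp add: algebra_simps add_divide_distrib diff_divide_distrib)
  qed
  \<comment> \<open>With the sums as atoms, only a polynomial identity in these names
    remains.\<close>
  define P C V G H Y Z where "P = (\<Sum>k\<in>K. a' k / (x - q k) + a k * p k / (x - q k)\<^sup>2)"
    and "C = (\<Sum>k\<in>K. a k / (x - q k) ^ 3)" and "V = (\<Sum>k\<in>K. a k / (x - q k)\<^sup>2)"
    and "G = (\<Sum>k\<in>K. a k / (x - q k))" and "H = (\<Sum>k\<in>K. 1 / (x - q k)\<^sup>2)"
    and "Y = (\<Sum>k\<in>K. x - q k)" and "Z = (\<Sum>k\<in>K. a k)"
  have "G * H = (\<Sum>k\<in>K. a k / (x - q k) ^ 3 + A k / (x - q k)\<^sup>2 + D k / (x - q k))"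
    and "Y * H = (\<Sum>k\<in>K. L k / (x - q k)\<^sup>2 + ?n / (x - q k))"
    unfolding G_def H_def Y_def A_def D_def L_def
    by (rule simple_times_double_poles[OF K x] linear_times_double_poles[OF x], assumption)+
  moreover have "(\<Sum>k\<in>K. ?F k + 1 / \<kappa> * a k) = (\<Sum>k\<in>K. ?F k) + 1 / \<kappa> * Z"
    unfolding sum.distrib sum_distrib_left Z_def ..
  ultimately have "P + 2 / \<kappa> * C - 1 / \<kappa> * ((t - x\<^sup>2) * V) - 2 / \<kappa> * (G * H) + 2 * c * H - 2 * \<mu> * (Y * H)
      = (\<Sum>k\<in>K. ?F k) + 1 / \<kappa> * Z"
    using main v unfolding P_def C_def V_def H_def by simp
  then have "P - \<kappa> * c' - \<kappa> * \<mu> * (\<Sum>k\<in>K. p k) + 2 / \<kappa> * C + (t - x\<^sup>2) * (\<mu> * ?n - 1 / \<kappa> * V)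
      - 2 * (1 / \<kappa> * G - c + \<mu> * Y) * H
    = (\<Sum>k\<in>K. ?F k) + 1 / \<kappa> * Z - \<kappa> * c' - \<kappa> * \<mu> * (\<Sum>k\<in>K. p k) + (t - x\<^sup>2) * (\<mu> * ?n)"
    by (simp add: algebra_simps)
  then show ?thesis
    unfolding P_def C_def V_def G_def H_def Y_def Z_def D A L
    by (simp add: algebra_simps power2_eq_square)
qed

subsection \<open>Derivatives\<close>

lemma has_vector_derivative_quotient:
  fixes f g :: "real \<Rightarrow> 'a::real_normed_field"
  assumes f: "(f has_vector_derivative f') (at t)" and g: "(g has_vector_derivative g') (at t)"
    and nz: "g t \<noteq> 0"
  shows "((\<lambda>s. f s / g s) has_vector_derivative f' / g t - f t * g' / (g t)\<^sup>2) (at t)"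
proof -
  have "(inverse has_field_derivative - (inverse (g t) ^ 2)) (at (g t))"
    using DERIV_inverse[OF nz] by (simp add: numeral_2_eq_2)
  from field_vector_diff_chain_at[OF g this]
  have "((\<lambda>s. inverse (g s)) has_vector_derivative g' * (- (inverse (g t) ^ 2))) (at t)"
    by (simp add: o_def)
  from has_vector_derivative_mult[OF f this]
  show ?thesis by (simp add: divide_inverse power_inverse algebra_simps)
qed

lemma has_vector_derivative_square:
  fixes f :: "real \<Rightarrow> 'a::real_normed_field"
  assumes "(f has_vector_derivative f') (at t)"
  shows "((\<lambda>s. (f s)\<^sup>2) has_vector_derivative 2 * f t * f') (at t)"
  using has_vector_derivative_mult[OF assms assms] by (simp add: power2_eq_square algebra_simps)

lemma has_vector_derivative_of_real_id:
  "((of_real :: real \<Rightarrow> 'a::real_normed_field) has_vector_derivative 1) (at t)"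
  using bounded_linear.has_vector_derivative[OF bounded_linear_of_real has_vector_derivative_id] by simp

lemma has_vector_derivative_pole_t:
  fixes a q :: "real \<Rightarrow> 'a::real_normed_field"
  assumes "(a has_vector_derivative a') (at t)" "(q has_vector_derivative q') (at t)" "z \<noteq> q t"
  shows "((\<lambda>s. a s / (z - q s)) has_vector_derivative a' / (z - q t) + a t * q' / (z - q t)\<^sup>2) (at t)"
  using has_vector_derivative_quotient[OF assms(1) has_vector_derivative_diff[OF has_vector_derivative_const assms(2)], of z]
    assms(3) by simp

lemma has_vector_derivative_pole_x:
  fixes q :: "'a::real_normed_field"
  assumes "of_real x \<noteq> q"
  shows "((\<lambda>y. a / (of_real y - q)) has_vector_derivative - a / (of_real x - q)\<^sup>2) (at x)"
  using has_vector_derivative_quotient[OF has_vector_derivative_const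
      has_vector_derivative_diff[OF has_vector_derivative_of_real_id has_vector_derivative_const], of x q a]
    assms by simp

lemma has_vector_derivative_double_pole_x:
  fixes q :: "'a::real_normed_field"
  assumes "of_real x \<noteq> q"
  shows "((\<lambda>y. a / (of_real y - q)\<^sup>2) has_vector_derivative - 2 * a / (of_real x - q) ^ 3) (at x)"
proof -
  have "a * (2 * y) / (y\<^sup>2)\<^sup>2 = 2 * a / y ^ 3" if "y \<noteq> 0" for y :: 'a
    using that by (simp add: power2_eq_square power3_eq_cube mult.commute mult.assoc)
  from this[of "of_real x - q"] show ?thesis
    using has_vector_derivative_quotient[OF has_vector_derivative_const has_vector_derivative_square[OF
          has_vector_derivative_diff[OF has_vector_derivative_of_real_id has_vector_derivative_const]], of x q a]
      assms by simp
qed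

lemma smooth_on_has_vector_derivative:
  assumes "smooth_on I f" "open I" "t \<in> I"
  shows "(f has_vector_derivative vderiv f t) (at t)"
    and "(vderiv f has_vector_derivative vderiv (vderiv f) t) (at t)"
proof -
  have "(vderiv ^^ n) f differentiable at t" for n
    using assms unfolding smooth_on_def differentiable_on_def
    by (metis at_within_open)
  from this[of 0] this[of 1]
  show "(f has_vector_derivative vderiv f t) (at t)"
    "(vderiv f has_vector_derivative vderiv (vderiv f) t) (at t)"
    by (simp_all add: vector_derivative_works)
qed

text \<open>For differentiating closed forms that are valid only away from the poles.\<close>

lemma vector_derivative_cong_open:
  assumes "(f has_vector_derivative f') (at x)" "open S" "x \<in> S" "\<And>y. y \<in> S \<Longrightarrow> f y = g y"
  shows "vector_derivative g (at x) = f'"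
  using has_vector_derivative_transform_within_open[OF assms] by (rule vector_derivative_at)

subsection \<open>The coefficients of the system\<close>

locale pole_system =
  fixes \<kappa> :: real and N :: nat and I :: "real set"
    and Q :: "nat \<Rightarrow> real \<Rightarrow> 'a::real_normed_field" and J0 :: "real \<Rightarrow> 'a"
  assumes kappa_pos: "\<kappa> > 0" and N_ge_1: "N \<ge> 1" and open_I: "open I"
    and smooth_Q: "k \<in> {1..N} \<Longrightarrow> smooth_on I (Q k)"
    and distinct_Q: "t \<in> I \<Longrightarrow> j \<in> {1..N} \<Longrightarrow> k \<in> {1..N} \<Longrightarrow> j \<noteq> k \<Longrightarrow> Q j t \<noteq> Q k t"
    and smooth_J0: "smooth_on I J0"
begin

abbreviation "K \<equiv> {1..N}"

abbreviation kap :: 'a where "kap \<equiv> of_real \<kappa>"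

definition regular :: "real \<Rightarrow> real set" where
  "regular t = {x. \<forall>k\<in>K. of_real x \<noteq> Q k t}"

text \<open>\<open>a k t / kap\<close> is the residue of \<open>2 * b_one\<close> at
  \<open>Q k t\<close>; \<open>c\<close> and \<open>\<mu>\<close> collect its constant and linear
  parts.\<close>

definition a :: "nat \<Rightarrow> real \<Rightarrow> 'a" where
  "a k t = kap * vderiv (Q k) t + of_real t - (Q k t)\<^sup>2 - 2 * R N Q k t"

definition a' :: "nat \<Rightarrow> real \<Rightarrow> 'a" where
  "a' k t = kap * vderiv (vderiv (Q k)) t + 1 - 2 * Q k t * vderiv (Q k) t
     + 2 * (\<Sum>j\<in>K - {k}. (vderiv (Q k) t - vderiv (Q j) t) / (Q k t - Q j t)\<^sup>2)"

definition c :: "real \<Rightarrow> 'a" where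
  "c t = 2 / kap * (\<Sum>k\<in>K. Q k t) + J0 t"

definition c' :: "real \<Rightarrow> 'a" where
  "c' t = 2 / kap * (\<Sum>k\<in>K. vderiv (Q k) t) + vderiv J0 t"

definition \<mu> :: 'a where "\<mu> = 1 / of_nat N - 1 / kap"

lemma kappa_nz [simp]: "\<kappa> \<noteq> 0" using kappa_pos by simp

lemma kap_nz: "kap \<noteq> 0" by simp

lemma regularD: "x \<in> regular t \<Longrightarrow> k \<in> K \<Longrightarrow> of_real x \<noteq> Q k t"
  by (auto simp: regular_def)

lemma open_regular: "open (regular t)"
proof -
  have "regular t = (\<Inter>k\<in>K. {x. of_real x \<noteq> Q k t})" by (auto simp: regular_def)
  moreover have "open {x. of_real x \<noteq> Q k t}" for k
    by (intro open_Collect_neq continuous_intros)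
  ultimately show ?thesis by auto
qed

lemma infinite_of_real_range: "infinite (range (of_real :: real \<Rightarrow> 'a))"
  using finite_imageD[of "of_real :: real \<Rightarrow> 'a" UNIV] infinite_UNIV_char_0 by (auto simp: inj_def)

lemma inj_Q: "t \<in> I \<Longrightarrow> inj_on (\<lambda>k. Q k t) K"
  by (rule inj_onI) (metis distinct_Q)

lemmas Q_deriv = smooth_on_has_vector_derivative[OF smooth_Q open_I]
lemmas J0_deriv = smooth_on_has_vector_derivative(1)[OF smooth_J0 open_I]

lemma b_one_eq: "b_one \<kappa> N Q J0 t x = 1 / 2 * (1 / kap * (\<Sum>k\<in>K. a k t / (of_real x - Q k t))
    - c t + \<mu> * (\<Sum>k\<in>K. of_real x - Q k t))"
  by (simp add: b_one_def a_def c_def \<mu>_def)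

lemma R_deriv:
  assumes "t \<in> I" "k \<in> K"
  shows "(R N Q k has_vector_derivative
    - (\<Sum>j\<in>K - {k}. (vderiv (Q k) t - vderiv (Q j) t) / (Q k t - Q j t)\<^sup>2)) (at t)"
proof -
  have "((\<lambda>s. \<Sum>j\<in>K - {k}. 1 / (Q k s - Q j s)) has_vector_derivative
      (\<Sum>j\<in>K - {k}. 0 / (Q k t - Q j t) - 1 * (vderiv (Q k) t - vderiv (Q j) t) / (Q k t - Q j t)\<^sup>2)) (at t)"
    by (intro has_vector_derivative_sum has_vector_derivative_quotient has_vector_derivative_const
        has_vector_derivative_diff Q_deriv) (use assms distinct_Q[of t] in force)+
  then show ?thesis by (simp add: R_def[abs_def] sum_negf)
qed

lemma a_deriv:
  assumes "t \<in> I" "k \<in> K"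
  shows "(a k has_vector_derivative a' k t) (at t)"
proof -
  have "(a k has_vector_derivative kap * vderiv (vderiv (Q k)) t + 1 - 2 * Q k t * vderiv (Q k) t
     - 2 * - (\<Sum>j\<in>K - {k}. (vderiv (Q k) t - vderiv (Q j) t) / (Q k t - Q j t)\<^sup>2)) (at t)"
    unfolding a_def[abs_def]
    by (intro has_vector_derivative_add has_vector_derivative_diff has_vector_derivative_mult_right
        has_vector_derivative_of_real_id has_vector_derivative_square R_deriv Q_deriv assms)
  then show ?thesis by (simp add: a'_def)
qed

lemma c_deriv:
  assumes "t \<in> I"
  shows "(c has_vector_derivative c' t) (at t)"
  unfolding c_def[abs_def] c'_def
  by (intro has_vector_derivative_add has_vector_derivative_mult_right has_vector_derivative_sum
      Q_deriv J0_deriv assms)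

section \<open>Partial derivatives of \<open>b_one\<close> and \<open>b_plus\<close>\<close>

lemma partial_t_b_one:
  assumes "t \<in> I" "x \<in> regular t"
  shows "partial_t (b_one \<kappa> N Q J0) t x = 1 / 2 * (1 / kap *
      (\<Sum>k\<in>K. a' k t / (of_real x - Q k t) + a k t * vderiv (Q k) t / (of_real x - Q k t)\<^sup>2)
      - c' t - \<mu> * (\<Sum>k\<in>K. vderiv (Q k) t))"
proof -
  have "((\<lambda>s. b_one \<kappa> N Q J0 s x) has_vector_derivative 1 / 2 * (1 / kap *
      (\<Sum>k\<in>K. a' k t / (of_real x - Q k t) + a k t * vderiv (Q k) t / (of_real x - Q k t)\<^sup>2)
      - c' t + \<mu> * (\<Sum>k\<in>K. 0 - vderiv (Q k) t))) (at t)"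
    unfolding b_one_eq
    by (intro has_vector_derivative_mult_right has_vector_derivative_add has_vector_derivative_diff
        has_vector_derivative_sum has_vector_derivative_pole_t a_deriv c_deriv Q_deriv
        has_vector_derivative_const regularD assms)
  from vector_derivative_at[OF this] show ?thesis by (simp add: sum_negf)
qed

lemma partial_x_b_one:
  assumes "x \<in> regular t"
  shows "partial_x (b_one \<kappa> N Q J0) t x = 1 / 2 * (\<mu> * of_nat N
      - 1 / kap * (\<Sum>k\<in>K. a k t / (of_real x - Q k t)\<^sup>2))"
proof -
  have "(b_one \<kappa> N Q J0 t has_vector_derivative 1 / 2 * (1 / kap *
      (\<Sum>k\<in>K. - a k t / (of_real x - Q k t)\<^sup>2) - 0 + \<mu> * (\<Sum>k\<in>K. 1 - 0))) (at x)"
    unfolding b_one_eq[abs_def]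
    by (intro has_vector_derivative_mult_right has_vector_derivative_add has_vector_derivative_diff
        has_vector_derivative_sum has_vector_derivative_pole_x has_vector_derivative_const
        has_vector_derivative_of_real_id regularD assms)
  from vector_derivative_at[OF this] show ?thesis by (simp add: sum_negf)
qed

lemma partial_xx_b_one:
  assumes "x \<in> regular t"
  shows "partial_x (partial_x (b_one \<kappa> N Q J0)) t x
    = 1 / kap * (\<Sum>k\<in>K. a k t / (of_real x - Q k t) ^ 3)"
proof -
  have "((\<lambda>x. 1 / 2 * (\<mu> * of_nat N - 1 / kap * (\<Sum>k\<in>K. a k t / (of_real x - Q k t)\<^sup>2)))
      has_vector_derivative 1 / 2 * (0 - 1 / kap * (\<Sum>k\<in>K. - 2 * a k t / (of_real x - Q k t) ^ 3))) (at x)"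
    by (intro has_vector_derivative_mult_right has_vector_derivative_diff
        has_vector_derivative_sum has_vector_derivative_double_pole_x has_vector_derivative_const
        regularD assms)
  from vector_derivative_cong_open[OF this open_regular assms partial_x_b_one[symmetric]]
  have "partial_x (partial_x (b_one \<kappa> N Q J0)) t x
      = 1 / 2 * (0 - 1 / kap * (\<Sum>k\<in>K. - 2 * a k t / (of_real x - Q k t) ^ 3))" .
  also have "(\<Sum>k\<in>K. - 2 * a k t / (of_real x - Q k t) ^ 3) = - 2 * (\<Sum>k\<in>K. a k t / (of_real x - Q k t) ^ 3)"
    by (simp add: sum_distrib_left)
  finally show ?thesis by simp
qed

lemma partial_x_b_plus:
  assumes "x \<in> regular t"
  shows "partial_x (b_plus \<kappa> N Q) t x = 1 / kap * (\<Sum>k\<in>K. 1 / (of_real x - Q k t)\<^sup>2)"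
proof -
  have "(b_plus \<kappa> N Q t has_vector_derivative
      - (1 / kap) * (\<Sum>k\<in>K. - 1 / (of_real x - Q k t)\<^sup>2)) (at x)"
    unfolding b_plus_def[abs_def]
    by (intro has_vector_derivative_mult_right has_vector_derivative_sum has_vector_derivative_pole_x regularD assms)
  from vector_derivative_at[OF this] show ?thesis by (simp add: sum_negf)
qed

lemma partial_t_first:
  assumes "t \<in> I" "x \<in> regular t"
  shows "partial_t (\<lambda>t x. kap * b_plus \<kappa> N Q t x + v t x) t x
    = 1 - (\<Sum>k\<in>K. vderiv (Q k) t / (of_real x - Q k t)\<^sup>2)"
proof -
  have "((\<lambda>s. kap * b_plus \<kappa> N Q s x + (of_real s - (of_real x)\<^sup>2)) has_vector_derivative
     kap * (- (1 / kap) * (\<Sum>k\<in>K. 0 / (of_real x - Q k t) + 1 * vderiv (Q k) t / (of_real x - Q k t)\<^sup>2))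
       + (1 - 0)) (at t)"
    unfolding b_plus_def
    by (intro has_vector_derivative_add has_vector_derivative_mult_right has_vector_derivative_sum
        has_vector_derivative_pole_t has_vector_derivative_diff has_vector_derivative_of_real_id
        has_vector_derivative_const regularD Q_deriv assms)
  from vector_derivative_at[OF this] show ?thesis by (simp add: v_def)
qed

section \<open>The first equation\<close>

text \<open>The double poles of \<open>partial_x b_plus\<close> and \<open>kap * b_plus^2\<close>
  cancel by \<open>square_sum_inverse\<close>, leaving \<open>- 2 * R\<close> residues that
  \<open>b_one\<close> compensates. Dividing \<open>v\<close> by \<open>x - Q k t\<close> cancels
  the \<open>t - (Q k t)\<^sup>2\<close> residues, the sum of the \<open>Q k t\<close> in
  \<open>c\<close> and the \<open>1 / kap\<close> part of \<open>\<mu>\<close>.\<close>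

lemma flux_eq:
  assumes "t \<in> I" "x \<in> regular t"
  shows "partial_x (b_plus \<kappa> N Q) t x - b_plus \<kappa> N Q t x * (kap * b_plus \<kappa> N Q t x + v t x)
      - 2 * b_one \<kappa> N Q J0 t x
    = J0 t - (\<Sum>k\<in>K. vderiv (Q k) t / (of_real x - Q k t)) - 1 / of_nat N * (\<Sum>k\<in>K. of_real x - Q k t)"
proof -
  define X G H r where "X = (of_real x :: 'a)" and "G = (\<Sum>k\<in>K. 1 / (X - Q k t))"
    and "H = (\<Sum>k\<in>K. 1 / (X - Q k t)\<^sup>2)" and "r = (\<Sum>k\<in>K. R N Q k t / (X - Q k t))"
  define W P Y where "W = (\<Sum>k\<in>K. (of_real t - (Q k t)\<^sup>2) / (X - Q k t))"
    and "P = (\<Sum>k\<in>K. vderiv (Q k) t / (X - Q k t))" and "Y = (\<Sum>k\<in>K. X - Q k t)"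
  have X: "X \<noteq> Q k t" if "k \<in> K" for k using regularD[OF assms(2) that] by (simp add: X_def)
  have G2: "G\<^sup>2 = H + 2 * r"
    using square_sum_inverse[OF _ inj_Q[OF assms(1)] X] by (simp add: G_def H_def r_def R_def)
  have vG: "v t x * G = W - Y - 2 * (\<Sum>k\<in>K. Q k t)"
    unfolding G_def W_def Y_def sum_distrib_left sum_subtractf[symmetric]
  proof (intro sum.cong refl)
    fix k assume "k \<in> K"
    then have "X - Q k t \<noteq> 0" using X by auto
    then show "v t x * (1 / (X - Q k t)) = (of_real t - (Q k t)\<^sup>2) / (X - Q k t) - (X - Q k t) - 2 * Q k t"
      by (simp add: v_def X_def[symmetric] divide_simps) (simp add: algebra_simps power2_eq_square)
  qed
  have aG: "(\<Sum>k\<in>K. a k t / (X - Q k t)) = kap * P + W - 2 * r"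
    unfolding P_def W_def r_def sum_distrib_left sum_subtractf[symmetric] sum.distrib[symmetric]
    by (intro sum.cong refl) (simp add: a_def add_divide_distrib diff_divide_distrib)
  have "partial_x (b_plus \<kappa> N Q) t x - b_plus \<kappa> N Q t x * (kap * b_plus \<kappa> N Q t x + v t x)
      - 2 * b_one \<kappa> N Q J0 t x
    = 1 / kap * H - 1 / kap * G\<^sup>2 + 1 / kap * (v t x * G)
      - (1 / kap * (kap * P + W - 2 * r) - c t + \<mu> * Y)"
    unfolding partial_x_b_plus[OF assms(2)] unfolding b_one_eq b_plus_def X_def[symmetric] G_def[symmetric]
      H_def[symmetric] aG Y_def[symmetric]
    by (simp add: field_simps power2_eq_square)
  also have "\<dots> = J0 t - P - 1 / of_nat N * Y"
    unfolding G2 vG by (simp add: c_def \<mu>_def field_simps)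
  finally show ?thesis by (simp add: P_def Y_def X_def)
qed

lemma first_equation:
  assumes "t \<in> I" "x \<in> regular t"
  shows "partial_t (\<lambda>t x. kap * b_plus \<kappa> N Q t x + v t x) t x
        + partial_x (\<lambda>t x. partial_x (b_plus \<kappa> N Q) t x
                      - b_plus \<kappa> N Q t x * (kap * b_plus \<kappa> N Q t x + v t x)
                      - 2 * b_one \<kappa> N Q J0 t x) t x = 0"
proof -
  \<comment> \<open>The linear term has derivative \<open>- (1 / N) * N = - 1\<close>, against the
    \<open>1\<close> from \<open>v\<close> in \<open>partial_t_first\<close>.\<close>
  have "((\<lambda>x. J0 t - (\<Sum>k\<in>K. vderiv (Q k) t / (of_real x - Q k t)) - 1 / of_nat N * (\<Sum>k\<in>K. of_real x - Q k t))
    has_vector_derivative 0 - (\<Sum>k\<in>K. - vderiv (Q k) t / (of_real x - Q k t)\<^sup>2) - 1 / of_nat N * (\<Sum>k\<in>K. 1 - 0)) (at x)"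
    by (intro has_vector_derivative_diff has_vector_derivative_mult_right has_vector_derivative_sum
        has_vector_derivative_pole_x has_vector_derivative_of_real_id has_vector_derivative_const
        regularD assms)
  from vector_derivative_cong_open[OF this open_regular assms(2) flux_eq[OF assms(1), symmetric]]
  show ?thesis unfolding partial_t_first[OF assms] using N_ge_1 by (simp add: sum_negf)
qed

section \<open>The second equation\<close>

text \<open>\<open>N\<close> and \<open>kap\<close> are kept apart here and in
  \<open>energy_defect\<close>, since the expansion must hold before \<open>N = \<kappa>\<close> is
  known.\<close>

definition residue_defect :: "nat \<Rightarrow> real \<Rightarrow> 'a" where
  "residue_defect k t = kap\<^sup>2 * vderiv (vderiv (Q k)) t + 2 * Q k t * (of_real t - (Q k t)\<^sup>2)
     + kap - 2 * (of_nat N - 1) + (\<Sum>j\<in>K - {k}. 8 / (Q k t - Q j t) ^ 3)"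

definition energy_defect :: "nat \<Rightarrow> real \<Rightarrow> 'a" where
  "energy_defect k t = (kap * vderiv (Q k) t)\<^sup>2 / 2 + of_real t * (Q k t)\<^sup>2 - (Q k t) ^ 4 / 2
            - (of_nat N - 2) * Q k t
            - (\<Sum>j\<in>K - {k}. 2 / (Q k t - Q j t)\<^sup>2)
            + U \<kappa> N Q J0 t
            - (\<Sum>j\<in>K - {k}. (kap * vderiv (Q k) t + kap * vderiv (Q j) t) / (Q k t - Q j t))
            + (\<Sum>j\<in>K - {k}. \<Sum>l\<in>K - {k, j}. 2 / ((Q k t - Q j t) * (Q j t - Q l t)))"

lemma second_equation_expansion:
  assumes "t \<in> I" "x \<in> regular t"
  shows "2 * (kap * partial_t (b_one \<kappa> N Q J0) t x + partial_x (partial_x (b_one \<kappa> N Q J0)) t x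
        + v t x * partial_x (b_one \<kappa> N Q J0) t x
        - 2 * kap * b_one \<kappa> N Q J0 t x * partial_x (b_plus \<kappa> N Q) t x)
   = (\<Sum>k\<in>K. (residue_defect k t / kap - 2 * \<mu> * of_nat N) / (of_real x - Q k t)
        + (2 * energy_defect k t / kap - 2 * \<mu> * (\<Sum>j\<in>K. Q k t - Q j t)) / (of_real x - Q k t)\<^sup>2)
      + poly [:- kap * c' t - kap * \<mu> * (\<Sum>k\<in>K. vderiv (Q k) t) + \<mu> * of_nat N * of_real t
          + 1 / kap * (\<Sum>k\<in>K. a k t), 0, - \<mu> * of_nat N:] (of_real x)"
proof -
  let ?q = "\<lambda>k. Q k t" and ?p = "\<lambda>k. vderiv (Q k) t"
  define X where "X = (of_real x :: 'a)"
  have X: "X \<noteq> Q k t" if "k \<in> K" for k using regularD[OF assms(2) that] by (simp add: X_def)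
  have inj: "inj_on ?q K" by (rule inj_Q[OF assms(1)])
  have res: "kap * a' k t + 2 * Q k t * a k t - 2 * (\<Sum>j\<in>K - {k}. (a k t - a j t) / (Q k t - Q j t)\<^sup>2)
      = residue_defect k t" if "k \<in> K" for k
    using residue_equation[OF _ inj that, where \<kappa> = kap and p = ?p and t = "of_real t"
        and p' = "\<lambda>k. vderiv (vderiv (Q k)) t"]
    by (simp add: residue_defect_def a_def a'_def R_def)
  have en: "a k t * (kap * vderiv (Q k) t - (of_real t - (Q k t)\<^sup>2))
      - 2 * (\<Sum>j\<in>K - {k}. a j t / (Q k t - Q j t)) + 2 * (kap * c t) = 2 * energy_defect k t"
    if "k \<in> K" for k
  proof -
    have "kap * c t = 2 * (\<Sum>j\<in>K. Q j t) + kap * J0 t" by (simp add: c_def distrib_left)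
    then show ?thesis
      using double_pole_equation[OF _ inj that, where \<kappa> = kap and p = ?p and t = "of_real t" and J = "J0 t"]
      by (simp add: energy_defect_def a_def R_def U_def)
  qed
  define S1 S2 S3 S4 S5 Y Z where "S1 = (\<Sum>k\<in>K. a' k t / (X - Q k t) + a k t * vderiv (Q k) t / (X - Q k t)\<^sup>2)"
    and "S2 = (\<Sum>k\<in>K. a k t / (X - Q k t) ^ 3)" and "S3 = (\<Sum>k\<in>K. a k t / (X - Q k t)\<^sup>2)"
    and "S4 = (\<Sum>k\<in>K. a k t / (X - Q k t))" and "S5 = (\<Sum>k\<in>K. 1 / (X - Q k t)\<^sup>2)"
    and "Y = (\<Sum>k\<in>K. X - Q k t)" and "Z = (\<Sum>k\<in>K. vderiv (Q k) t)"
  note exp = master_expansion[OF finite_atLeastAtMost inj X kap_nz, where a' = "\<lambda>k. a' k t"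
      and a = "\<lambda>k. a k t" and p = ?p and c' = "c' t" and \<mu> = \<mu> and t = "of_real t" and c = "c t",
      folded S1_def S2_def S3_def S4_def S5_def Y_def Z_def, unfolded card_atLeastAtMost diff_Suc_1]
  have v: "v t x = of_real t - X\<^sup>2" by (simp add: v_def X_def)
  have "2 * (kap * partial_t (b_one \<kappa> N Q J0) t x + partial_x (partial_x (b_one \<kappa> N Q J0)) t x
        + v t x * partial_x (b_one \<kappa> N Q J0) t x
        - 2 * kap * b_one \<kappa> N Q J0 t x * partial_x (b_plus \<kappa> N Q) t x)
    = S1 - kap * c' t - kap * \<mu> * Z + 2 / kap * S2 + (of_real t - X\<^sup>2) * (\<mu> * of_nat N - 1 / kap * S3)
      - 2 * (1 / kap * S4 - c t + \<mu> * Y) * S5"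
    unfolding partial_t_b_one[OF assms] partial_xx_b_one[OF assms(2)] partial_x_b_one[OF assms(2)] v
      partial_x_b_plus[OF assms(2)]
    unfolding b_one_eq X_def[symmetric] S1_def[symmetric] S2_def[symmetric]
      S3_def[symmetric] S4_def[symmetric] S5_def[symmetric] Y_def[symmetric] Z_def[symmetric]
    by (simp add: field_simps)
  also note exp
  finally show ?thesis
    by (simp only: res en X_def Z_def cong: sum.cong)
qed

lemma U_deriv:
  assumes "t \<in> I"
  shows "vderiv (U \<kappa> N Q J0) t = kap * vderiv J0 t + (\<Sum>k\<in>K. vderiv (Q k) t) - of_real t"
proof -
  have "((\<lambda>s. kap * J0 s + (\<Sum>k\<in>K. Q k s) - 1 / 2 * (of_real s)\<^sup>2) has_vector_derivative
      kap * vderiv J0 t + (\<Sum>k\<in>K. vderiv (Q k) t) - 1 / 2 * (2 * of_real t * 1)) (at t)"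
    by (intro has_vector_derivative_add has_vector_derivative_diff has_vector_derivative_mult_right
        has_vector_derivative_sum has_vector_derivative_square has_vector_derivative_of_real_id
        Q_deriv J0_deriv assms)
  from vector_derivative_at[OF this] show ?thesis by (simp add: U_def[abs_def])
qed

text \<open>The pair terms \<open>1 / (Q k t - Q j t)\<close> in \<open>R\<close> cancel against
  their transposes.\<close>

lemma sum_a:
  "(\<Sum>k\<in>K. a k t) = kap * (\<Sum>k\<in>K. vderiv (Q k) t) + of_nat N * of_real t - (\<Sum>k\<in>K. (Q k t)\<^sup>2)"
proof -
  have "(\<Sum>k\<in>K. R N Q k t) = 0"
    unfolding R_def by (rule sum_R_eq_0) simp
  then show ?thesis
    by (simp add: a_def sum.distrib sum_subtractf sum_distrib_left[symmetric])
qed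

lemma mu_eq_0_iff: "\<mu> = 0 \<longleftrightarrow> real N = \<kappa>"
proof -
  have "\<mu> = of_real (1 / real N - 1 / \<kappa>)" by (simp add: \<mu>_def)
  then have "\<mu> = 0 \<longleftrightarrow> 1 / real N - 1 / \<kappa> = 0" by (simp only: of_real_eq_0_iff)
  then show ?thesis using N_ge_1 by (auto simp: field_simps)
qed

text \<open>Pointwise in \<open>t\<close>: for one fixed time, the values of the derivatives are
  just the coefficients of a rational function of \<open>x\<close>.\<close>

lemma second_equation_iff:
  assumes "t \<in> I"
  shows "(\<forall>x\<in>regular t. kap * partial_t (b_one \<kappa> N Q J0) t x + partial_x (partial_x (b_one \<kappa> N Q J0)) t x
        + v t x * partial_x (b_one \<kappa> N Q J0) t x
        = 2 * kap * b_one \<kappa> N Q J0 t x * partial_x (b_plus \<kappa> N Q) t x)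
    \<longleftrightarrow> real N = \<kappa> \<and> kap * vderiv (U \<kappa> N Q J0) t = - (\<Sum>k\<in>K. (Q k t)\<^sup>2)
      \<and> (\<forall>k\<in>K. residue_defect k t = 0) \<and> (\<forall>k\<in>K. energy_defect k t = 0)"
    (is "(\<forall>x\<in>_. ?l x = ?r x) \<longleftrightarrow> ?rhs")
proof -
  let ?\<alpha> = "\<lambda>k. residue_defect k t / kap - 2 * \<mu> * of_nat N"
  let ?\<beta> = "\<lambda>k. 2 * energy_defect k t / kap - 2 * \<mu> * (\<Sum>j\<in>K. Q k t - Q j t)"
  let ?c0 = "- kap * c' t - kap * \<mu> * (\<Sum>k\<in>K. vderiv (Q k) t) + \<mu> * of_nat N * of_real t
          + 1 / kap * (\<Sum>k\<in>K. a k t)"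
  let ?p = "[:?c0, 0, - \<mu> * of_nat N:]"
  have exp: "2 * (?l x - ?r x) = (\<Sum>k\<in>K. ?\<alpha> k / (of_real x - Q k t) + ?\<beta> k / (of_real x - Q k t)\<^sup>2)
      + poly ?p (of_real x)" if "x \<in> regular t" for x
    using second_equation_expansion[OF assms that] .
  \<comment> \<open>Only for \<open>\<mu> = 0\<close> do the extra terms drop and
    \<open>of_nat N / kap\<close> become 1, which supplies the \<open>t\<close> contained in the
    derivative of \<open>U\<close>.\<close>
  have p0: "?c0 = - (1 / kap) * (kap * vderiv (U \<kappa> N Q J0) t + (\<Sum>k\<in>K. (Q k t)\<^sup>2))"
    if "\<mu> = 0"
  proof -
    have "real N = \<kappa>" using that mu_eq_0_iff by simp
    then have "of_nat N = kap" by (metis of_real_of_nat_eq)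
    then show ?thesis
      unfolding U_deriv[OF assms] sum_a c'_def that by (simp add: field_simps)
  qed
  show ?thesis
  proof
    assume eq: "\<forall>x\<in>regular t. ?l x = ?r x"
    have *: "(\<Sum>k\<in>K. ?\<alpha> k / (X - Q k t) + ?\<beta> k / (X - Q k t)\<^sup>2) + poly ?p X = 0"
      if "X \<in> range of_real" "\<forall>k\<in>K. X \<noteq> Q k t" for X
    proof -
      obtain x where x: "X = of_real x" "x \<in> regular t" using \<open>X \<in> range of_real\<close> \<open>\<forall>k\<in>K. X \<noteq> Q k t\<close>
        by (auto simp: regular_def)
      show ?thesis unfolding x(1) exp[OF x(2), symmetric] using eq x(2) by simp
    qed
    note unique = partial_fraction_unique[OF finite_atLeastAtMost inj_Q[OF assms] infinite_of_real_range,
        where \<alpha> = ?\<alpha> and \<beta> = ?\<beta> and p = ?p]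
    have \<alpha>: "?\<alpha> k = 0" and \<beta>: "?\<beta> k = 0" if "k \<in> K" for k
      by (rule unique(2)[OF * that] unique(3)[OF * that]; assumption)+
    \<comment> \<open>The top coefficient \<open>- \<mu> * of_nat N\<close> decides first:
      \<open>N \<ge> 1\<close> forces \<open>\<mu> = 0\<close>, which then cleans
      \<open>?\<alpha>\<close>, \<open>?\<beta>\<close> and \<open>?c0\<close>.\<close>
    have "?p = 0"
      by (rule unique(1)[OF *])
    then have mu: "\<mu> = 0" and "?c0 = 0"
      using N_ge_1 by (simp_all only: pCons_eq_0_iff) simp_all
    then have "kap * vderiv (U \<kappa> N Q J0) t = - (\<Sum>k\<in>K. (Q k t)\<^sup>2)"
      using p0[OF mu] by (simp add: eq_neg_iff_add_eq_0)
    moreover have "residue_defect k t = 0" "energy_defect k t = 0" if "k \<in> K" for k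
      using \<alpha>[OF that] \<beta>[OF that] mu by simp_all
    ultimately show ?rhs using mu mu_eq_0_iff by blast
  next
    assume rhs: ?rhs
    then have mu: "\<mu> = 0" using mu_eq_0_iff by simp
    have "?c0 = 0" unfolding p0[OF mu] using rhs by simp
    then have "2 * (?l x - ?r x) = 0" if "x \<in> regular t" for x
      unfolding exp[OF that] using rhs mu by simp
    then have "?l x - ?r x = 0" if "x \<in> regular t" for x
      using that by (metis mult_eq_0_iff zero_neq_numeral)
    then show "\<forall>x\<in>regular t. ?l x = ?r x"
      unfolding right_minus_eq by blast
  qed
qed

text \<open>With \<open>N = \<kappa>\<close> the constants combine as
  \<open>kap - 2 * (kap - 1) = - (kap - 2)\<close>.\<close>

lemma residue_defect_eq_0_iff:
  assumes "real N = \<kappa>"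
  shows "residue_defect k t = 0 \<longleftrightarrow>
    kap\<^sup>2 * vderiv (vderiv (Q k)) t = - 2 * Q k t * (of_real t - (Q k t)\<^sup>2) + kap - 2
      - (\<Sum>j\<in>K - {k}. 8 / (Q k t - Q j t) ^ 3)"
proof -
  have N: "of_nat N = kap" using assms by (metis of_real_of_nat_eq)
  have "residue_defect k t = kap\<^sup>2 * vderiv (vderiv (Q k)) t
      - (- 2 * Q k t * (of_real t - (Q k t)\<^sup>2) + kap - 2 - (\<Sum>j\<in>K - {k}. 8 / (Q k t - Q j t) ^ 3))"
    unfolding residue_defect_def N by (simp add: algebra_simps)
  then show ?thesis by simp
qed

end

theorem mainTheorem2:
  fixes \<kappa> :: real and N :: nat and I :: "real set"
    and Q :: "nat \<Rightarrow> real \<Rightarrow> 'a::real_normed_field" and J0 :: "real \<Rightarrow> 'a"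
  assumes "\<kappa> > 0" and "N \<ge> 1"
    and "open I" and "is_interval I" and "I \<noteq> {}"
    and "\<And>k. k \<in> {1..N} \<Longrightarrow> smooth_on I (Q k)"
    and "\<And>t j k. t \<in> I \<Longrightarrow> j \<in> {1..N} \<Longrightarrow> k \<in> {1..N} \<Longrightarrow> j \<noteq> k \<Longrightarrow> Q j t \<noteq> Q k t"
    and "smooth_on I J0"
  shows
    "(\<forall>t\<in>I. \<forall>x. (\<forall>k\<in>{1..N}. of_real x \<noteq> Q k t) \<longrightarrow>
        partial_t (\<lambda>t x. of_real \<kappa> * b_plus \<kappa> N Q t x + v t x) t x
        + partial_x (\<lambda>t x. partial_x (b_plus \<kappa> N Q) t x
                      - b_plus \<kappa> N Q t x * (of_real \<kappa> * b_plus \<kappa> N Q t x + v t x)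
                      - 2 * b_one \<kappa> N Q J0 t x) t x
        = 0)
     \<and>
     ((\<forall>t\<in>I. \<forall>x. (\<forall>k\<in>{1..N}. of_real x \<noteq> Q k t) \<longrightarrow>
        of_real \<kappa> * partial_t (b_one \<kappa> N Q J0) t x
        + partial_x (partial_x (b_one \<kappa> N Q J0)) t x
        + v t x * partial_x (b_one \<kappa> N Q J0) t x
        = 2 * of_real \<kappa> * b_one \<kappa> N Q J0 t x * partial_x (b_plus \<kappa> N Q) t x)
      \<longleftrightarrow>
      (real N = \<kappa>
       \<and> (\<forall>t\<in>I. of_real \<kappa> * vderiv (U \<kappa> N Q J0) t = - (\<Sum>k=1..N. (Q k t)\<^sup>2))
       \<and> (\<forall>t\<in>I. \<forall>k\<in>{1..N}.
            (of_real \<kappa>)\<^sup>2 * vderiv (vderiv (Q k)) t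
            = - 2 * Q k t * (of_real t - (Q k t)\<^sup>2) + of_real \<kappa> - 2
              - (\<Sum>j\<in>{1..N} - {k}. 8 / (Q k t - Q j t) ^ 3))
       \<and> (\<forall>t\<in>I. \<forall>k\<in>{1..N}.
            (of_real \<kappa> * vderiv (Q k) t)\<^sup>2 / 2 + of_real t * (Q k t)\<^sup>2 - (Q k t) ^ 4 / 2
            - (of_real \<kappa> - 2) * Q k t
            - (\<Sum>j\<in>{1..N} - {k}. 2 / (Q k t - Q j t)\<^sup>2)
            + U \<kappa> N Q J0 t
            - (\<Sum>j\<in>{1..N} - {k}.
                 (of_real \<kappa> * vderiv (Q k) t + of_real \<kappa> * vderiv (Q j) t) / (Q k t - Q j t))
            + (\<Sum>j\<in>{1..N} - {k}. \<Sum>l\<in>{1..N} - {k, j}.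
                 2 / ((Q k t - Q j t) * (Q j t - Q l t)))
            = 0)))"
proof -
  interpret pole_system \<kappa> N I Q J0
    by unfold_locales (use assms in auto)
  have second: "(\<forall>t\<in>I. \<forall>x. (\<forall>k\<in>{1..N}. of_real x \<noteq> Q k t) \<longrightarrow>
        of_real \<kappa> * partial_t (b_one \<kappa> N Q J0) t x
        + partial_x (partial_x (b_one \<kappa> N Q J0)) t x
        + v t x * partial_x (b_one \<kappa> N Q J0) t x
        = 2 * of_real \<kappa> * b_one \<kappa> N Q J0 t x * partial_x (b_plus \<kappa> N Q) t x)
    \<longleftrightarrow> (\<forall>t\<in>I. real N = \<kappa> \<and> kap * vderiv (U \<kappa> N Q J0) t = - (\<Sum>k\<in>K. (Q k t)\<^sup>2)
      \<and> (\<forall>k\<in>K. residue_defect k t = 0) \<and> (\<forall>k\<in>K. energy_defect k t = 0))"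
    by (rule ball_cong[OF refl], drule second_equation_iff) (simp only: regular_def Ball_def mem_Collect_eq)
  \<comment> \<open>Moving the time-independent \<open>P\<close> out of the quantifier needs a point
    of \<open>I\<close>: over an empty set the left side would hold vacuously.\<close>
  have distrib: "(\<forall>t\<in>I. P \<and> A t \<and> B t \<and> C t) \<longleftrightarrow> P \<and> (\<forall>t\<in>I. A t) \<and> (\<forall>t\<in>I. B t) \<and> (\<forall>t\<in>I. C t)"
    for P and A B C :: "real \<Rightarrow> bool"
    using \<open>I \<noteq> {}\<close> by blast
  have N: "of_nat N = kap" if "real N = \<kappa>" using that by (metis of_real_of_nat_eq)
  show ?thesis
    unfolding second distrib
  proof (rule conjI, goal_cases)
    case 1
    show ?case using first_equation unfolding regular_def by (simp only: mem_Collect_eq) simp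
  next
    case 2
    show ?case
    \<comment> \<open>Rewriting \<open>N\<close> to \<open>\<kappa>\<close> is possible only when
      they agree; otherwise both sides are false through their first conjunct.\<close>
    proof (cases "real N = \<kappa>")
      case True
      show ?thesis
        unfolding residue_defect_eq_0_iff[OF True] energy_defect_def N[OF True] ..
    qed (simp only: simp_thms)
  qed
qed

end
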